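(* Let $0<q<p<1$ and let $f,F:[0,\infty)\to\mathbb{R}$. If $F$ is a $pq$-antiderivative of $f$, i.e. $D_{pq}F(x)=f(x)$, and $F$ is continuous at $x=0$ and at $x=1$, then for every $0\le a<b\le\infty$, $$\int_{a}^{b}f(x)\,d_{pq}x=F(b)-F(a),$$ where, for $b=\infty$, $F(\infty)$ means $\lim_{x\to\infty}F(x)$, and this limit is assumed to exist.
   Context: The $pq$-derivative of $F$ is $D_{pq}F(x)=\dfrac{F(x^{p})-F(x^{q})}{x^{p}-x^{q}}$ for $x\ne0,1$, with $D_{pq}F(0)=\lim_{x\to0^+}D_{pq}F(x)$ and $D_{pq}F(1)=\lim_{x\to1}D_{pq}F(x)$. The $pq$-integrals are defined as follows (all infinite sums being limits of partial sums; a bi-infinite sum is the sum of its two one-sided halves). (1) For $c>1$: $\int_{1}^{c}f\,d_{pq}x=\sum_{j=0}^{\infty}\left(c^{q^{j}p^{-j}}-c^{q^{j+1}p^{-j-1}}\right)f\left(c^{q^{j}p^{-j-1}}\right)$; for $1<a<b<\infty$: $\int_a^b f\,d_{pq}x=\int_1^b f\,d_{pq}x-\int_1^a f\,d_{pq}x$. (2) For $0<c<1$: $\int_{c}^{1}f\,d_{pq}x=\sum_{j=0}^{\infty}\left(c^{q^{j+1}p^{-j-1}}-c^{q^{j}p^{-j}}\right)f\left(c^{q^{j}p^{-j-1}}\right)$. (3) For $0<c<1$: $\int_{0}^{c}f\,d_{pq}x=\sum_{j=0}^{\infty}\left(c^{q^{-j}p^{j}}-c^{q^{-j-1}p^{j+1}}\right)f\left(c^{q^{-j-1}p^{j}}\right)$;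 for $0<a<b<1$: $\int_a^b f\,d_{pq}x=\int_0^b f\,d_{pq}x-\int_0^a f\,d_{pq}x$. (4) $\int_0^1 f\,d_{pq}x=\sum_{j=-\infty}^{\infty}\left(p^{q^{j+1}p^{-j-1}}-p^{q^{j}p^{-j}}\right)f\left(p^{q^{j}p^{-j-1}}\right)$, where the base of the powers is the number $p$. (5) For $0\le a<1<b<\infty$: $\int_a^b f\,d_{pq}x=\int_a^1 f\,d_{pq}x+\int_1^b f\,d_{pq}x$. (6) With $\beta=p/q>1$: $\int_1^{\infty}f\,d_{pq}x=\sum_{j=-\infty}^{\infty}\left(\beta^{q^{j}p^{-j}}-\beta^{q^{j+1}p^{-j-1}}\right)f\left(\beta^{q^{j}p^{-j-1}}\right)$. (7) For $0\le a<1$: $\int_a^\infty f\,d_{pq}x=\int_a^1 f\,d_{pq}x+\int_1^\infty f\,d_{pq}x$. For $a>1$: $\int_a^\infty f\,d_{pq}x=\lim_{N\to\infty}\sum_{j=1}^{N}\int_{a^{q^{-j+1}p^{j-1}}}^{a^{q^{-j}p^{j}}}f\,d_{pq}x$. Exponents are real powers, e.g. $c^{q^{j}p^{-j}}$ is $c$ raised to the power $(q/p)^j$. *)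

theory Defs
  imports Complex_Main "HOL-Library.Extended_Real"
begin

text \<open>
  Functions on \<open>[0,\<infinity>)\<close> are rendered as functions on the reals; all notions below only
  use their values at nonnegative arguments.
\<close>

definition pq_quotient :: "real \<Rightarrow> real \<Rightarrow> (real \<Rightarrow> real) \<Rightarrow> real \<Rightarrow> real" where
  "pq_quotient p q F x = (F (x powr p) - F (x powr q)) / (x powr p - x powr q)"

text \<open>
  The statement \<open>D\<^sub>p\<^sub>q F(x) = d\<close>, as a relation: at \<open>0\<close> and \<open>1\<close>
  it includes the existence of the defining limit.
\<close>

definition has_pq_derivative ::
    "real \<Rightarrow> real \<Rightarrow> (real \<Rightarrow> real) \<Rightarrow> real \<Rightarrow> real \<Rightarrow> bool" where
  "has_pq_derivative p q F d x \<longleftrightarrow>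
     (if x = 0 then (pq_quotient p q F \<longlongrightarrow> d) (at_right 0)
      else if x = 1 then (pq_quotient p q F \<longlongrightarrow> d) (at 1)
      else pq_quotient p q F x = d)"

definition pq_antiderivative ::
    "real \<Rightarrow> real \<Rightarrow> (real \<Rightarrow> real) \<Rightarrow> (real \<Rightarrow> real) \<Rightarrow> bool" where
  "pq_antiderivative p q F f \<longleftrightarrow> (\<forall>x\<ge>0. has_pq_derivative p q F (f x) x)"

definition bi_sums :: "(int \<Rightarrow> real) \<Rightarrow> real \<Rightarrow> bool" where
  "bi_sums g s \<longleftrightarrow>
     (\<exists>s1 s2. (\<lambda>n. g (int n)) sums s1 \<and> (\<lambda>n. g (- int n - 1)) sums s2 \<and> s = s1 + s2)"

definition pq_pow :: "real \<Rightarrow> real \<Rightarrow> real \<Rightarrow> int \<Rightarrow> int \<Rightarrow> real" where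
  "pq_pow p q c i k = c powr (q powi i * p powi k)"

text \<open>
  \<open>has_pq_integral p q f a b I\<close> says that the \<open>pq\<close>-integral of \<open>f\<close> from
  \<open>a\<close> to \<open>b\<close> exists (all series and limits involved converge) and equals \<open>I\<close>.
  The rules have mutually exclusive ranges of \<open>(a, b)\<close>, so \<open>I\<close> is unique; see
  \<open>has_pq_integral_unique\<close>.
\<close>

inductive has_pq_integral ::
    "real \<Rightarrow> real \<Rightarrow> (real \<Rightarrow> real) \<Rightarrow> real \<Rightarrow> ereal \<Rightarrow> real \<Rightarrow> bool"
  for p q :: real and f :: "real \<Rightarrow> real" where
  from_1:
    "has_pq_integral p q f 1 (ereal c) I"
    if "1 < c"
      "(\<lambda>j::nat. (pq_pow p q c (int j) (- int j) - pq_pow p q c (int j + 1) (- int j - 1))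
                  * f (pq_pow p q c (int j) (- int j - 1))) sums I"
| above_1:
    "has_pq_integral p q f a (ereal b) (I - J)"
    if "1 < a" "a < b"
      "has_pq_integral p q f 1 (ereal b) I" "has_pq_integral p q f 1 (ereal a) J"
| to_1:
    "has_pq_integral p q f c (ereal 1) I"
    if "0 < c" "c < 1"
      "(\<lambda>j::nat. (pq_pow p q c (int j + 1) (- int j - 1) - pq_pow p q c (int j) (- int j))
                  * f (pq_pow p q c (int j) (- int j - 1))) sums I"
| from_0:
    "has_pq_integral p q f 0 (ereal c) I"
    if "0 < c" "c < 1"
      "(\<lambda>j::nat. (pq_pow p q c (- int j) (int j) - pq_pow p q c (- int j - 1) (int j + 1))
                  * f (pq_pow p q c (- int j - 1) (int j))) sums I"
| below_1:
    "has_pq_integral p q f a (ereal b) (I - J)"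
    if "0 < a" "a < b" "b < 1"
      "has_pq_integral p q f 0 (ereal b) I" "has_pq_integral p q f 0 (ereal a) J"
| from_0_to_1:
    "has_pq_integral p q f 0 (ereal 1) I"
    if "bi_sums (\<lambda>j. (pq_pow p q p (j + 1) (- j - 1) - pq_pow p q p j (- j))
                       * f (pq_pow p q p j (- j - 1))) I"
| across_1:
    "has_pq_integral p q f a (ereal b) (I + J)"
    if "0 \<le> a" "a < 1" "1 < b"
      "has_pq_integral p q f a (ereal 1) I" "has_pq_integral p q f 1 (ereal b) J"
| from_1_to_inf:
    "has_pq_integral p q f 1 \<infinity> I"
    if "bi_sums (\<lambda>j. (pq_pow p q (p / q) j (- j) - pq_pow p q (p / q) (j + 1) (- j - 1))
                       * f (pq_pow p q (p / q) j (- j - 1))) I"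
| across_1_to_inf:
    "has_pq_integral p q f a \<infinity> (I + J)"
    if "0 \<le> a" "a < 1"
      "has_pq_integral p q f a (ereal 1) I" "has_pq_integral p q f 1 \<infinity> J"
| above_1_to_inf:
    "has_pq_integral p q f a \<infinity> L"
    if "1 < a"
      "\<forall>j::nat\<ge>1. has_pq_integral p q f
                     (pq_pow p q a (- int j + 1) (int j - 1)) (ereal (pq_pow p q a (- int j) (int j))) (I j)"
      "(\<lambda>N. \<Sum>j=1..N. I j) \<longlonglongrightarrow> L"

lemma bi_sums_unique: "bi_sums g s \<Longrightarrow> bi_sums g t \<Longrightarrow> s = t"
  unfolding bi_sums_def using sums_unique2 by blast

lemma has_pq_integral_unique:
  "has_pq_integral p q f a b I \<Longrightarrow> has_pq_integral p q f a b J \<Longrightarrow> I = J"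
proof (induction arbitrary: J rule: has_pq_integral.induct)
  case from_1
  from from_1.prems from_1.hyps show ?case
    by cases (auto dest: sums_unique2)
next
  case above_1
  from above_1.prems above_1.hyps show ?case
    by cases (auto dest!: above_1.IH)
next
  case to_1
  from to_1.prems to_1.hyps show ?case
    by cases (auto dest: sums_unique2)
next
  case from_0
  from from_0.prems from_0.hyps show ?case
    by cases (auto dest: sums_unique2)
next
  case below_1
  from below_1.prems below_1.hyps show ?case
    by cases (auto dest!: below_1.IH)
next
  case from_0_to_1
  from from_0_to_1.prems from_0_to_1.hyps show ?case
    by cases (auto dest: bi_sums_unique)
next
  case across_1
  from across_1.prems across_1.hyps show ?case
    by cases (auto dest!: across_1.IH)
next
  case from_1_to_inf
  from from_1_to_inf.prems from_1_to_inf.hyps show ?case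
    by cases (auto dest: bi_sums_unique)
next
  case across_1_to_inf
  from across_1_to_inf.prems across_1_to_inf.hyps show ?case
    by cases (auto dest!: across_1_to_inf.IH)
next
  case (above_1_to_inf a I L)
  from above_1_to_inf.prems above_1_to_inf.hyps obtain I' where I':
    "\<forall>j::nat\<ge>1. has_pq_integral p q f
        (pq_pow p q a (- int j + 1) (int j - 1)) (ereal (pq_pow p q a (- int j) (int j))) (I' j)"
    "(\<lambda>N. \<Sum>j=1..N. I' j) \<longlonglongrightarrow> J"
    by cases auto
  have "I j = I' j" if "j \<ge> 1" for j
    using above_1_to_inf.IH I'(1) that by blast
  then have "(\<lambda>N. \<Sum>j=1..N. I j) = (\<lambda>N. \<Sum>j=1..N. I' j)"
    by (intro ext sum.cong) auto
  with I'(2) above_1_to_inf.hyps show ?case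
    using LIMSEQ_unique by metis
qed

text \<open>\<open>F(b)\<close> for an extended real \<open>b\<close>, where \<open>F(\<infinity>)\<close> is the limit at infinity.\<close>

definition ext_value :: "(real \<Rightarrow> real) \<Rightarrow> ereal \<Rightarrow> real" where
  "ext_value F b = (if b = \<infinity> then Lim at_top F else F (real_of_ereal b))"

end

(* With r = q/p, the sample point x = c^(q^j p^(-j-1)) satisfies x^p = c^(r^j) and
   x^q = c^(r^(j+1)), so every summand of a pq-integral is a difference of consecutive values of F
   along the sequence c^(r^j), and all the series telescope. This sequence tends to 1 as j tends
   to infinity, and to 0 (if c < 1) or infinity (if c > 1) as j tends to minus infinity; continuity
   of F at 0 and 1 and the limit of F at infinity then identify the sums. *)

theory Submission
  imports Defs "HOL-Analysis.Elementary_Topology"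
begin

section \<open>Bi-infinite telescoping sums\<close>

lemma bi_sums_telescope:
  assumes "(\<lambda>n. H (int n)) \<longlonglongrightarrow> L" and "(\<lambda>n. H (- int n)) \<longlonglongrightarrow> M"
  shows "bi_sums (\<lambda>j. H (j + 1) - H j) (L - M)"
  unfolding bi_sums_def
\<comment> \<open>The two halves telescope separately, to \<open>L - H 0\<close> and
  \<open>H 0 - M\<close>; the shared value \<open>H 0\<close> cancels.\<close>
proof (intro exI conjI)
  show "(\<lambda>n. H (int n + 1) - H (int n)) sums (L - H 0)"
    using telescope_sums[OF assms(1)] by (simp add: add.commute)
  \<comment> \<open>These turn the summand at index \<open>- n - 1\<close> into
    \<open>H (- int n) - H (- int (Suc n))\<close>, a decreasing difference of consecutive
    terms.\<close>
  have "- int n - 1 = - int (Suc n)" "- int (Suc n) + 1 = - int n" for n by simp_all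
  then show "(\<lambda>n. H (- int n - 1 + 1) - H (- int n - 1)) sums (H 0 - M)"
    using telescope_sums'[OF assms(2)] by (simp only: of_nat_0 minus_zero)
qed simp

lemma pq_pow_eq_powr:
  assumes "p \<noteq> 0"
  shows "pq_pow p q c j (- j) = c powr ((q / p) powi j)"
  using assms by (simp add: pq_pow_def power_int_divide_distrib power_int_minus field_simps)

section \<open>Limits of the points c^(r^j) for j tending to plus or minus infinity\<close>

context
  fixes p q :: real
  assumes q_pos: "0 < q" and q_less_p: "q < p"
begin

lemma ratio_bounds: "0 < q / p" "q / p < 1"
  using q_pos q_less_p by simp_all

lemma powr_ratio_tendsto_1:
  assumes "0 < c"
  shows "(\<lambda>n. c powr ((q / p) powi int n)) \<longlonglongrightarrow> 1"
proof -
  have "(\<lambda>n. c powr ((q / p) ^ n)) \<longlonglongrightarrow> c powr 0"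
    using assms ratio_bounds by (intro tendsto_intros LIMSEQ_realpow_zero) auto
  with assms show ?thesis by simp
qed

lemma ratio_powi_minus_at_top:
  "filterlim (\<lambda>n. (q / p) powi (- int n)) at_top sequentially"
proof -
  have "filterlim (\<lambda>n. inverse ((q / p) ^ n)) at_top sequentially"
    using ratio_bounds by (intro filterlim_inverse_at_top LIMSEQ_realpow_zero) auto
  then show ?thesis
    by (simp add: power_int_minus)
qed

lemma powr_ratio_tendsto_0:
  assumes "0 < c" "c < 1"
  shows "(\<lambda>n. c powr ((q / p) powi (- int n))) \<longlonglongrightarrow> 0"
proof -
  \<comment> \<open>The constant factor must be positive; as c < 1, this is
    \<open>- ln c\<close>.\<close>
  have "filterlim (\<lambda>n. (q / p) powi (- int n) * (- ln c)) at_top sequentially"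
    using assms by (intro filterlim_at_top_mult_tendsto_pos[OF tendsto_const _ ratio_powi_minus_at_top]) simp
  then have "filterlim (\<lambda>n. (q / p) powi (- int n) * ln c) at_bot sequentially"
    by (simp add: filterlim_uminus_at_bot)
  from filterlim_compose[OF exp_at_bot this] show ?thesis
    using assms by (simp add: powr_def)
qed

lemma powr_ratio_at_top:
  assumes "1 < c"
  shows "filterlim (\<lambda>n. c powr ((q / p) powi (- int n))) at_top sequentially"
proof -
  have "filterlim (\<lambda>n. (q / p) powi (- int n) * ln c) at_top sequentially"
    using assms by (intro filterlim_at_top_mult_tendsto_pos[OF tendsto_const _ ratio_powi_minus_at_top]) simp
  from filterlim_compose[OF exp_at_top this] show ?thesis
    using assms by (simp add: powr_def)
qed

section \<open>Summands as increments of F\<close>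

text \<open>Away from 0 and 1 the derivative is the plain quotient, and there its denominator is
  nonzero because t -> x^t is injective and q < p.\<close>

lemma pq_antiderivative_increment:
  assumes "pq_antiderivative p q F f" "0 < x" "x \<noteq> 1"
  shows "(x powr p - x powr q) * f x = F (x powr p) - F (x powr q)"
proof -
  have "pq_quotient p q F x = f x"
    using assms unfolding pq_antiderivative_def has_pq_derivative_def by force
  moreover have "x powr p \<noteq> x powr q"
    using assms q_less_p by (simp add: powr_def)
  ultimately show ?thesis
    by (auto simp: pq_quotient_def field_simps)
qed

text \<open>Stated for every integer j and on both sides of 1, so that one-sided and bi-infinite
  sums can share it; the integrals below 1 use its negation.\<close>

lemma pq_integral_summand:
  assumes F: "pq_antiderivative p q F f" and c: "0 < c" "c \<noteq> 1"
  shows "(pq_pow p q c j (- j) - pq_pow p q c (j + 1) (- j - 1)) * f (pq_pow p q c j (- j - 1))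
    = F (c powr ((q / p) powi j)) - F (c powr ((q / p) powi (j + 1)))"
proof -
  define e where "e = q powi j * p powi (- j - 1)"
  have p0: "p > 0" using q_pos q_less_p by simp
  have e: "e > 0" using q_pos p0 by (simp add: e_def)
  have "p powi (- j - 1) * p = p powi (- j)"
    using p0 by (simp add: power_int_diff)
  then have ep: "e * p = (q / p) powi j"
    using p0 by (simp add: e_def power_int_divide_distrib power_int_minus field_simps)
  have eq: "e * q = (q / p) powi (j + 1)"
    using ep p0 q_pos by (simp add: power_int_add field_simps)
  \<comment> \<open>A nonzero exponent keeps the sample point away from 1, where f is only a limit
    of quotients.\<close>
  have "c powr e \<noteq> 1"
    using c e by (simp add: powr_def)
  then have "((c powr e) powr p - (c powr e) powr q) * f (c powr e)
      = F ((c powr e) powr p) - F ((c powr e) powr q)"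
    using F c by (intro pq_antiderivative_increment) auto
  then show ?thesis
    using pq_pow_eq_powr[of p q c j] pq_pow_eq_powr[of p q c "j + 1"] p0
    by (simp add: powr_powr ep eq) (simp add: pq_pow_def e_def)
qed

section \<open>The integral over each kind of interval\<close>

context
  fixes F f :: "real \<Rightarrow> real"
  assumes antideriv: "pq_antiderivative p q F f"
    and cont_0: "continuous (at 0 within {0..}) F"
    and cont_1: "continuous (at 1 within {0..}) F"
begin

text \<open>Values of \<open>powr\<close> are nonnegative, so the sequence stays in
  \<open>{0..}\<close>, the set within which F is continuous at 1.\<close>

lemma tendsto_F_1:
  assumes "0 < c"
  shows "(\<lambda>n. F (c powr ((q / p) powi int n))) \<longlonglongrightarrow> F 1"
  using continuous_within_tendsto_compose'[OF cont_1 _ powr_ratio_tendsto_1] assms by simp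

lemma tendsto_F_0:
  assumes "0 < c" "c < 1"
  shows "(\<lambda>n. F (c powr ((q / p) powi (- int n)))) \<longlonglongrightarrow> F 0"
  using continuous_within_tendsto_compose'[OF cont_0 _ powr_ratio_tendsto_0] assms by simp

lemma has_pq_integral_from_1:
  assumes "1 < c"
  shows "has_pq_integral p q f 1 (ereal c) (F c - F 1)"
proof (rule from_1)
  have c: "0 < c" "c \<noteq> 1" using assms by auto
  show "(\<lambda>j. (pq_pow p q c (int j) (- int j) - pq_pow p q c (int j + 1) (- int j - 1))
      * f (pq_pow p q c (int j) (- int j - 1))) sums (F c - F 1)"
    unfolding pq_integral_summand[OF antideriv c]
    using telescope_sums'[OF tendsto_F_1[OF c(1)]] c by (simp add: add.commute)
qed (use assms in auto)

lemma has_pq_integral_to_1: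
  assumes "0 < c" "c < 1"
  shows "has_pq_integral p q f c (ereal 1) (F 1 - F c)"
proof (rule to_1)
  have c: "0 < c" "c \<noteq> 1" using assms by auto
  \<comment> \<open>For c < 1 the points increase towards 1, so the rule orders each difference the
    other way round.\<close>
  have "(\<lambda>j. - ((pq_pow p q c (int j) (- int j) - pq_pow p q c (int j + 1) (- int j - 1))
      * f (pq_pow p q c (int j) (- int j - 1)))) sums (F 1 - F c)"
    unfolding pq_integral_summand[OF antideriv c]
    using telescope_sums[OF tendsto_F_1[OF c(1)]] c by (simp add: add.commute)
  then show "(\<lambda>j. (pq_pow p q c (int j + 1) (- int j - 1) - pq_pow p q c (int j) (- int j))
      * f (pq_pow p q c (int j) (- int j - 1))) sums (F 1 - F c)"
    by (simp add: algebra_simps)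
qed (use assms in auto)

lemma has_pq_integral_from_0:
  assumes "0 < c" "c < 1"
  shows "has_pq_integral p q f 0 (ereal c) (F c - F 0)"
proof (rule from_0)
  have Suc_eq: "- int (Suc j) = - int j - 1" for j by simp
  have summand: "(pq_pow p q c (- int j) (int j) - pq_pow p q c (- int j - 1) (int j + 1))
      * f (pq_pow p q c (- int j - 1) (int j))
    = F (c powr ((q / p) powi (- int j))) - F (c powr ((q / p) powi (- int (Suc j))))" for j
    \<comment> \<open>This sum runs through the negative indices, along which the points decrease
      from c to 0.\<close>
    unfolding Suc_eq using pq_integral_summand[OF antideriv, of c "- int j - 1"] assms
    by (simp add: algebra_simps)
  show "(\<lambda>j. (pq_pow p q c (- int j) (int j) - pq_pow p q c (- int j - 1) (int j + 1))
      * f (pq_pow p q c (- int j - 1) (int j))) sums (F c - F 0)"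
    unfolding summand using telescope_sums'[OF tendsto_F_0[of c]] assms by simp
qed (use assms in auto)

text \<open>The base of the powers is p itself, so \<open>p < 1\<close> is what sends the points to
  0 at the negative end.\<close>

lemma has_pq_integral_from_0_to_1:
  assumes "p < 1"
  shows "has_pq_integral p q f 0 (ereal 1) (F 1 - F 0)"
proof (rule from_0_to_1)
  have p: "0 < p" "p \<noteq> 1" using q_pos q_less_p assms by auto
  have summand: "(pq_pow p q p (j + 1) (- j - 1) - pq_pow p q p j (- j))
      * f (pq_pow p q p j (- j - 1))
    = F (p powr ((q / p) powi (j + 1))) - F (p powr ((q / p) powi j))" for j
    using pq_integral_summand[OF antideriv p, of j] by (simp add: algebra_simps)
  show "bi_sums (\<lambda>j. (pq_pow p q p (j + 1) (- j - 1) - pq_pow p q p j (- j))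
      * f (pq_pow p q p j (- j - 1))) (F 1 - F 0)"
    unfolding summand using p assms
    by (intro bi_sums_telescope[where H = "\<lambda>j. F (p powr ((q / p) powi j))"]
        tendsto_F_1 tendsto_F_0) auto
qed

lemma has_pq_integral_from_1_to_inf:
  assumes "(F \<longlongrightarrow> L) at_top"
  shows "has_pq_integral p q f 1 \<infinity> (L - F 1)"
proof (rule from_1_to_inf)
  define c where "c = p / q"
  have c: "1 < c" using q_pos q_less_p by (simp add: c_def)
  have summand: "(pq_pow p q c j (- j) - pq_pow p q c (j + 1) (- j - 1))
      * f (pq_pow p q c j (- j - 1))
    = - F (c powr ((q / p) powi (j + 1))) - - F (c powr ((q / p) powi j))" for j
    using pq_integral_summand[OF antideriv, of c j] c by simp
  \<comment> \<open>Telescoping -F gives the order of differences that the rule has; the base p/q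
    exceeds 1, so the negative end tends to infinity and contributes -L.\<close>
  have "bi_sums (\<lambda>j. - F (c powr ((q / p) powi (j + 1))) - - F (c powr ((q / p) powi j)))
      (- F 1 - - L)"
    using c filterlim_compose[OF assms powr_ratio_at_top[OF c]]
    by (intro bi_sums_telescope[where H = "\<lambda>j. - F (c powr ((q / p) powi j))"]
        tendsto_minus tendsto_F_1) auto
  then show "bi_sums (\<lambda>j. (pq_pow p q (p / q) j (- j) - pq_pow p q (p / q) (j + 1) (- j - 1))
      * f (pq_pow p q (p / q) j (- j - 1))) (L - F 1)"
    unfolding summand[unfolded c_def] by (simp add: c_def)
qed

lemma has_pq_integral_above_1:
  assumes "1 < a" "a < b"
  shows "has_pq_integral p q f a (ereal b) (F b - F a)"
  using above_1[OF assms has_pq_integral_from_1 has_pq_integral_from_1] assms by simp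

lemma has_pq_integral_above_1_to_inf:
  assumes a: "1 < a" and L: "(F \<longlongrightarrow> L) at_top"
  shows "has_pq_integral p q f a \<infinity> (L - F a)"
proof (rule above_1_to_inf[OF a])
  \<comment> \<open>The cut points of the rule. They increase from a to infinity and stay above 1,
    so each piece is an integral between two points above 1, and the pieces telescope.\<close>
  define s where "s n = a powr ((q / p) powi (- int n))" for n
  have p0: "p \<noteq> 0" using q_pos q_less_p by simp
  have s0: "s 0 = a" using a by (simp add: s_def)
  have s_gt_1: "1 < s n" for n
    using a ratio_bounds by (simp add: s_def)
  have s_less: "s n < s (Suc n)" for n
  proof -
    have "(q / p) powi (- int n) < (q / p) powi (- int (Suc n))"
      using ratio_bounds by (intro power_int_strict_decreasing) auto
    then show ?thesis using a by (simp add: s_def)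
  qed
  have s_eq: "pq_pow p q a (- int n) (int n) = s n" for n
    using pq_pow_eq_powr[OF p0, of q a "- int n"] by (simp add: s_def)
  show "\<forall>j::nat\<ge>1. has_pq_integral p q f (pq_pow p q a (- int j + 1) (int j - 1))
      (ereal (pq_pow p q a (- int j) (int j))) (F (s j) - F (s (j - 1)))"
  proof (intro allI impI)
    fix j :: nat
    assume "j \<ge> 1"
    then obtain n where j: "j = Suc n" by (cases j) auto
    have "pq_pow p q a (- int j + 1) (int j - 1) = s n"
      using s_eq[of n] by (simp add: j)
    then show "has_pq_integral p q f (pq_pow p q a (- int j + 1) (int j - 1))
        (ereal (pq_pow p q a (- int j) (int j))) (F (s j) - F (s (j - 1)))"
      using has_pq_integral_above_1[OF s_gt_1 s_less, of n] s_eq[of j] by (simp add: j)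
  qed
  have "(\<Sum>j=1..N. F (s j) - F (s (j - 1))) = F (s N) - F a" for N
    using sum_telescope''[of 0 N "\<lambda>j. F (s j)"] by (simp add: s0 atLeastSucAtMost_greaterThanAtMost)
  moreover have "(\<lambda>N. F (s N) - F a) \<longlonglongrightarrow> L - F a"
    using filterlim_compose[OF L powr_ratio_at_top[OF a]] unfolding s_def
    by (intro tendsto_intros)
  ultimately show "(\<lambda>N. \<Sum>j=1..N. F (s j) - F (s (j - 1))) \<longlonglongrightarrow> L - F a"
    by simp
qed

end

end

section \<open>Case distinction on the endpoints\<close>

theorem theorem6p1:
  fixes p q a :: real and b :: ereal and f F :: "real \<Rightarrow> real"
  assumes "0 < q" and "q < p" and "p < 1"
    and "pq_antiderivative p q F f"
    and "continuous (at 0 within {0..}) F"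
    and "continuous (at 1 within {0..}) F"
    and "0 \<le> a" and "ereal a < b"
    and "b = \<infinity> \<Longrightarrow> \<exists>L. (F \<longlongrightarrow> L) at_top"
  shows "has_pq_integral p q f a b (ext_value F b - F a)"
proof -
  note hyps = assms(1,2,4-6)
  \<comment> \<open>Joins the bi-infinite rule at a = 0 with the one-sided rule at a > 0; every
    interval that ends at 1 or crosses it uses this.\<close>
  have to_1: "has_pq_integral p q f a (ereal 1) (F 1 - F a)" if "a < 1"
    using that assms(3,7) has_pq_integral_from_0_to_1[OF hyps] has_pq_integral_to_1[OF hyps, of a]
    by (cases "a = 0") auto
  show ?thesis
  proof (cases b)
    case (real c)
    with assms(8) have "a < c" by simp
    consider "1 < a" | "a = 1" | "a < 1" "1 < c" | "a < 1" "c = 1"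
      | "a = 0" "c < 1" | "0 < a" "c < 1"
      using assms(7) by linarith
    then have "has_pq_integral p q f a (ereal c) (F c - F a)"
    proof cases
      case 1
      then show ?thesis using has_pq_integral_above_1[OF hyps] \<open>a < c\<close> by simp
    next
      case 2
      then show ?thesis using has_pq_integral_from_1[OF hyps] \<open>a < c\<close> by simp
    next
      case 3
      then show ?thesis
        using across_1[OF assms(7) _ _ to_1 has_pq_integral_from_1[OF hyps]] by simp
    next
      case 4
      then show ?thesis using to_1 by simp
    next
      case 5
      then show ?thesis using has_pq_integral_from_0[OF hyps] \<open>a < c\<close> by simp
    next
      case 6
      then show ?thesis
        using below_1[OF _ \<open>a < c\<close> _ has_pq_integral_from_0[OF hyps] has_pq_integral_from_0[OF hyps]]
          \<open>a < c\<close> by simp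
    qed
    then show ?thesis by (simp add: real ext_value_def)
  next
    case PInf
    with assms(9) obtain L where L: "(F \<longlongrightarrow> L) at_top" by blast
    \<comment> \<open>\<open>Lim\<close> is a definite description; the existing limit L pins it
      down.\<close>
    then have ext: "ext_value F b = L"
      using PInf by (simp add: ext_value_def tendsto_Lim)
    consider "1 < a" | "a = 1" | "a < 1" by linarith
    then have "has_pq_integral p q f a \<infinity> (L - F a)"
    proof cases
      case 1
      then show ?thesis using has_pq_integral_above_1_to_inf[OF hyps _ L] by simp
    next
      case 2
      then show ?thesis using has_pq_integral_from_1_to_inf[OF hyps L] by simp
    next
      case 3
      then show ?thesis
        using across_1_to_inf[OF assms(7) _ to_1 has_pq_integral_from_1_to_inf[OF hyps L]] by simp
    qed
    then show ?thesis using PInf ext by simp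
  next
    case MInf
    with assms(8) show ?thesis by simp
  qed
qed

end
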